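(* In the setting described in the context, assume all sources have equal power $p_k=p$ for all $k$, let $\mathrm{SNR}=p/\sigma^2$, and assume $\mathcal{I}_w(\boldsymbol{\varrho})$ is non-singular so that $\mathrm{CRB}_w(\boldsymbol{\theta})$ is defined. Then, with $\boldsymbol{\theta}$, $K$, the array and $N$ fixed, $\lim_{\mathrm{SNR}\to\infty}\mathrm{CRB}_w(\boldsymbol{\theta})\succ\mathbf{0}$ (the limit is a positive definite matrix).
   Context: SLA with distinct integer sensor positions $m_1,\dots,m_M$, $K$ sources with distinct DoAs $\boldsymbol{\theta}=(\theta_1,\dots,\theta_K)^T\in[-\pi/2,\pi/2]^K$, $\mathbf{a}(\theta)=[e^{j\pi\sin\theta\,m_1},\dots,e^{j\pi\sin\theta\,m_M}]^T$, $\mathbf{A}(\boldsymbol{\theta})=[\mathbf{a}(\theta_1),\dots,\mathbf{a}(\theta_K)]$, source powers $p_k>0$, noise variance $\sigma^2>0$, $N$ snapshots (circular Gaussian uncorrelated sources and white Gaussian noise, one-bit quantization of real and imaginary parts of each sensor output). Normalized powers $\overline p_k=p_k/(\sigma^2+\sum_i p_i)$, $\overline{\mathbf{R}}=\mathbf{A}(\boldsymbol{\theta})\mathrm{diag}(\overline{\mathbf{p}})\mathbf{A}^H(\boldsymbol{\theta})+(1-\sum_k\overline p_k)\mathbf{I}_M$, $\mathbf{R}_{\mathbf{x}}=\frac{2}{\pi}\mathrm{asin}(\overline{\mathbf{R}})$ where $[\mathrm{asin}(\mathbf{C})]_{m,n}=\arcsin(\Re\{[\mathbf{C}]_{m,n}\})+j\arcsin(\Im\{[\mathbf{C}]_{m,n}\})$,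 and $\mathbf{r}_{\mathbf{x}}=\mathrm{vec}(\mathbf{R}_{\mathbf{x}})$ as a function of $\boldsymbol{\varrho}=(\theta_1,\dots,\theta_K,\overline p_1,\dots,\overline p_K)^T$. The Gaussian (worst-case) Fisher information matrix for the one-bit data is $[\mathcal{I}_w(\boldsymbol{\varrho})]_{m,n}=N\frac{\partial\mathbf{r}_{\mathbf{x}}^H}{\partial[\boldsymbol{\varrho}]_m}(\mathbf{R}_{\mathbf{x}}^{-T}\otimes\mathbf{R}_{\mathbf{x}}^{-1})\frac{\partial\mathbf{r}_{\mathbf{x}}}{\partial[\boldsymbol{\varrho}]_n}$, and the pessimistic CRB approximation $\mathrm{CRB}_w(\boldsymbol{\theta})$ is the upper-left $K\times K$ block of $\mathcal{I}_w(\boldsymbol{\varrho})^{-1}$ (i.e., the inverse of the Schur complement of the $\overline{\mathbf{p}}$-block in $\mathcal{I}_w(\boldsymbol{\varrho})$).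
   Formalization: Adds that R_x and I_w are also nonsingular at the infinite-SNR parameter (all normalized powers 1/K); without this the claim fails, e.g. one source at θ=0 with sensors at 0 and 1, where CRB_w tends to 0. *)

theory Defs
  imports "HOL-Analysis.Analysis"
begin

definition steer :: "('m::finite \<Rightarrow> int) \<Rightarrow> real \<Rightarrow> complex^'m" where
  "steer pos th = (\<chi> i. cis (pi * sin th * of_int (pos i)))"

definition param :: "real^'k \<Rightarrow> real^'k \<Rightarrow> real^('k + 'k)" where
  "param th pb = (\<chi> l. case l of Inl k \<Rightarrow> th $ k | Inr k \<Rightarrow> pb $ k)"

definition npow :: "real \<Rightarrow> real^'k::finite \<Rightarrow> real^'k" where
  "npow s2 p = (\<chi> k. p $ k / (s2 + (\<Sum>i\<in>UNIV. p $ i)))"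

definition Rbar :: "('m::finite \<Rightarrow> int) \<Rightarrow> real^('k::finite + 'k) \<Rightarrow> complex^'m^'m" where
  "Rbar pos rho = (\<chi> i j.
      (\<Sum>k\<in>UNIV. complex_of_real (rho $ Inr k) * (steer pos (rho $ Inl k)) $ i
                                  * cnj ((steer pos (rho $ Inl k)) $ j))
      + (if i = j then complex_of_real (1 - (\<Sum>k\<in>UNIV. rho $ Inr k)) else 0))"

definition casin :: "complex \<Rightarrow> complex" where
  "casin z = complex_of_real (arcsin (Re z)) + \<i> * complex_of_real (arcsin (Im z))"

definition Rx :: "('m::finite \<Rightarrow> int) \<Rightarrow> real^('k::finite + 'k) \<Rightarrow> complex^'m^'m" where
  "Rx pos rho = (\<chi> i j. complex_of_real (2 / pi) * casin ((Rbar pos rho) $ i $ j))"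

definition dRx :: "('m::finite \<Rightarrow> int) \<Rightarrow> real^('k::finite + 'k) \<Rightarrow> ('k + 'k) \<Rightarrow> complex^'m^'m" where
  "dRx pos rho n = (\<chi> i j. vector_derivative
      (\<lambda>t. (Rx pos (\<chi> l. if l = n then t else rho $ l)) $ i $ j) (at (rho $ n)))"

(* column-stacking vectorization: vec(X) indexed by (column, row) *)
definition vecm :: "'a^'n^'m \<Rightarrow> 'a^('n \<times> 'm)" where
  "vecm X = vec_lambda (\<lambda>(j, i). X $ i $ j)"

definition kron :: "'a::times^'n^'m \<Rightarrow> 'a^'q^'p \<Rightarrow> 'a^('n \<times> 'q)^('m \<times> 'p)" where
  "kron A B = vec_lambda (\<lambda>(a1, b1). vec_lambda (\<lambda>(a2, b2). A $ a1 $ a2 * B $ b1 $ b2))"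

(* Gaussian (worst-case) FIM:
   [I_w]_{a,b} = N (d r_x / d rho_a)^H (R_x^{-T} kron R_x^{-1}) (d r_x / d rho_b) *)
definition FIMw :: "('m::finite \<Rightarrow> int) \<Rightarrow> nat \<Rightarrow> real^('k::finite + 'k) \<Rightarrow> complex^('k + 'k)^('k + 'k)" where
  "FIMw pos N rho = (let Ri = matrix_inv (Rx pos rho);
                         W = kron (transpose Ri) Ri in
     (\<chi> a b. of_nat N * (\<Sum>q\<in>UNIV. cnj ((vecm (dRx pos rho a)) $ q)
                                      * ((W *v vecm (dRx pos rho b)) $ q))))"

definition CRBw :: "('m::finite \<Rightarrow> int) \<Rightarrow> nat \<Rightarrow> real^('k::finite + 'k) \<Rightarrow> complex^'k^'k" where
  "CRBw pos N rho = (\<chi> i j. (matrix_inv (FIMw pos N rho)) $ Inl i $ Inl j)"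

definition posdef :: "complex^'n^'n \<Rightarrow> bool" where
  "posdef L \<longleftrightarrow> (\<forall>i j. L $ i $ j = cnj (L $ j $ i)) \<and>
     (\<forall>x::complex^'n. x \<noteq> 0 \<longrightarrow> 0 < Re (\<Sum>i\<in>UNIV. cnj (x $ i) * (L *v x) $ i))"

end

theory Submission
  imports Defs
begin

text \<open>
  At infinite SNR the normalized powers are \<open>1 / K\<close>, and \<open>Rbar\<close> is a convex combination of
  rank-one steering matrices. The power series of \<open>arcsin\<close> has nonnegative coefficients, so by the
  Schur product theorem \<open>Rx\<close> is positive semidefinite. Writing \<open>D = R E R\<close> for a combination
  \<open>D\<close> of the derivative matrices, the quadratic form of the Fisher matrix becomes
  \<open>N tr (E\<^sup>H R E R) \<ge> 0\<close>; being Hermitian and nonsingular, the Fisher matrix is positive definite,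
  and so are its inverse and the diagonal block \<open>CRBw\<close>. Nonsingularity of the limiting \<open>Rx\<close> keeps
  the off-diagonal entries of \<open>Rbar\<close> away from the points \<open>\<plusminus>1\<close>, where \<open>arcsin\<close> is not
  differentiable. Hence the Fisher matrix is continuous at the limit, and by Cramer's rule so is its inverse.
\<close>

section \<open>The power series of \<open>arcsin\<close>\<close>

text \<open>The derivative \<open>1 / sqrt (1 - x^2)\<close> has a binomial series in
  \<open>x^2\<close> whose coefficients \<open>pochhammer (1/2) m / fact m\<close> are positive.
  Integrating it termwise divides them by positive integers, which keeps the sign.\<close>

lemma arcsin_power_series:
  obtains c :: "nat \<Rightarrow> real"
  where "\<And>n. 0 \<le> c n" and "\<And>x. \<bar>x\<bar> < 1 \<Longrightarrow> (\<lambda>n. c n * x ^ n) sums arcsin x"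
proof -
  define b :: "nat \<Rightarrow> real" where
    "b n = (if even n then pochhammer (1/2) (n div 2) / fact (n div 2) else 0)" for n
  \<comment> \<open>Integration sends \<open>x^(n-1)\<close> to \<open>x^n / n\<close>, hence the
    shift; the value at \<open>n = 0\<close> is \<open>arcsin 0\<close>.\<close>
  define c where "c n = (if n = 0 then 0 else b (n - 1) / real n)" for n
  have b_nonneg: "0 \<le> b n" for n
    using pochhammer_pos[of "1/2 :: real" "n div 2"] by (simp add: b_def)
  have b_sums: "(\<lambda>n. b n * x ^ n) sums inverse (sqrt (1 - x\<^sup>2))" if "\<bar>x\<bar> < 1" for x
  proof -
    have x2: "x\<^sup>2 < 1"
      using that by (simp add: abs_square_less_1)
    have "(\<lambda>n. ((-1/2) gchoose n) * (- x\<^sup>2) ^ n) sums (1 + (- x\<^sup>2)) powr (-1/2)"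
      by (rule gen_binomial_real) (use x2 in simp)
    also have "(1 + (- x\<^sup>2)) powr (-1/2) = inverse (sqrt (1 - x\<^sup>2))"
      using x2 by (simp add: powr_minus powr_half_sqrt)
    also have "(\<lambda>n. ((-1/2) gchoose n) * (- x\<^sup>2) ^ n) = (\<lambda>n. b (2 * n) * x ^ (2 * n))"
    proof
      fix n
      have "(- x\<^sup>2) ^ n = (-1) ^ n * x ^ (2 * n)"
        by (metis power_minus power_mult)
      moreover have "(-1 :: real) ^ n * (-1) ^ n = 1"
        by (simp flip: power_mult_distrib)
      ultimately show "((-1/2) gchoose n) * (- x\<^sup>2) ^ n = b (2 * n) * x ^ (2 * n)"
        by (simp add: b_def gbinomial_pochhammer)
    qed
    finally have even: "(\<lambda>n. b (2 * n) * x ^ (2 * n)) sums inverse (sqrt (1 - x\<^sup>2))" .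
    have "(\<lambda>n. b n * x ^ n) sums inverse (sqrt (1 - x\<^sup>2)) \<longleftrightarrow>
        (\<lambda>n. b (2 * n) * x ^ (2 * n)) sums inverse (sqrt (1 - x\<^sup>2))"
      by (rule sym, rule sums_mono_reindex[where g = "\<lambda>n. 2 * n"])
        (auto simp: strict_mono_def b_def elim!: evenE)
    with even show ?thesis by simp
  qed
  have c_summable: "summable (\<lambda>n. c n * x ^ n)" if "norm x < 1" for x :: real
  proof (rule summable_comparison_test)
    have "summable (\<lambda>n. b n * \<bar>x\<bar> ^ n)"
      by (rule sums_summable[OF b_sums]) (use that in simp)
    then have "summable (\<lambda>n. \<bar>x\<bar> * (b n * \<bar>x\<bar> ^ n))"
      by (rule summable_mult)
    then show "summable (\<lambda>n. b (n - 1) * \<bar>x\<bar> ^ n)"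
      by (subst summable_Suc_iff[symmetric]) (simp add: mult_ac)
    have "b (n - 1) / real n \<le> b (n - 1)" if "0 < n" for n
      using that b_nonneg[of "n - 1"] mult_right_mono[of 1 "real n" "b (n - 1)"]
      by (simp add: field_simps)
    then have "norm (c n * x ^ n) \<le> b (n - 1) * \<bar>x\<bar> ^ n" if "1 \<le> n" for n
      using that b_nonneg mult_right_mono[of "b (n - 1) / real n" "b (n - 1)" "\<bar>x\<bar> ^ n"]
      by (simp add: c_def abs_mult power_abs)
    then show "\<exists>N. \<forall>n\<ge>N. norm (c n * x ^ n) \<le> b (n - 1) * \<bar>x\<bar> ^ n"
      by blast
  qed
  have diffs_c: "diffs c = b"
    by (auto simp: diffs_def c_def fun_eq_iff simp del: of_nat_Suc)
  have eq: "arcsin x = (\<Sum>n. c n * x ^ n)" if "\<bar>x\<bar> < 1" for x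
  proof -
    let ?h = "\<lambda>x. arcsin x - (\<Sum>n. c n * x ^ n)"
    have "DERIV ?h y :> 0" if "y \<in> {-1<..<1}" for y
    proof -
      have y: "\<bar>y\<bar> < 1" using that by auto
      have "DERIV arcsin y :> inverse (sqrt (1 - y\<^sup>2))"
        using that by (intro DERIV_arcsin) auto
      moreover have "DERIV (\<lambda>x. \<Sum>n. c n * x ^ n) y :> (\<Sum>n. diffs c n * y ^ n)"
        using y by (intro termdiffs_strong'[of 1] c_summable) auto
      moreover have "(\<Sum>n. diffs c n * y ^ n) = inverse (sqrt (1 - y\<^sup>2))"
        unfolding diffs_c using b_sums[OF y] by (rule sums_unique[symmetric])
      ultimately show ?thesis
        using DERIV_diff by fastforce
    qed
    then have "?h x = ?h 0"
      using that by (intro DERIV_isconst3[of "-1" 1]) auto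
    also have "\<dots> = 0"
      using powser_sums_zero[of c] by (simp add: sums_iff c_def)
    finally show ?thesis by simp
  qed
  show ?thesis
  proof (rule that)
    show "0 \<le> c n" for n using b_nonneg by (simp add: c_def)
    show "(\<lambda>n. c n * x ^ n) sums arcsin x" if "\<bar>x\<bar> < 1" for x
      using summable_sums[OF c_summable[of x]] that eq[OF that] by simp
  qed
qed

subsection \<open>Positive semidefinite kernels\<close>

text \<open>Positive semidefiniteness is encoded as membership in the closed convex cone generated by
  the rank-one kernels; the Schur product theorem then needs no spectral decomposition.\<close>

inductive psd_kernel :: "('a \<Rightarrow> 'a \<Rightarrow> real) \<Rightarrow> bool" where
  rank_one: "psd_kernel (\<lambda>x y. f x * f y)"
| add: "psd_kernel K \<Longrightarrow> psd_kernel L \<Longrightarrow> psd_kernel (\<lambda>x y. K x y + L x y)"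
| limit: "(\<And>n. psd_kernel (K n)) \<Longrightarrow> (\<And>x y. (\<lambda>n::nat. K n x y) \<longlonglongrightarrow> L x y) \<Longrightarrow> psd_kernel L"

lemma psd_kernel_sym: "psd_kernel K \<Longrightarrow> K x y = K y x"
proof (induction arbitrary: x y rule: psd_kernel.induct)
  case (limit K L)
  have "(\<lambda>n. K n x y) = (\<lambda>n. K n y x)"
    using limit.IH by blast
  then show ?case
    using LIMSEQ_unique limit.hyps(2) by metis
qed (auto simp: mult.commute)

lemma psd_kernel_const: "0 \<le> c \<Longrightarrow> psd_kernel (\<lambda>x y. c)"
  using psd_kernel.rank_one[of "\<lambda>x. sqrt c"] by simp

text \<open>The Schur product theorem. The product of two rank-one kernels is the rank-one kernel of
  \<open>f * g\<close>; multiplication by a fixed kernel is additive and pointwise continuous, so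
  induction over each factor in turn covers the whole cone.\<close>

lemma psd_kernel_mult:
  assumes "psd_kernel K" "psd_kernel L"
  shows "psd_kernel (\<lambda>x y. K x y * L x y)"
  using assms
proof (induction rule: psd_kernel.induct)
  case (rank_one f)
  then show ?case
  proof (induction rule: psd_kernel.induct)
    case (rank_one g)
    show ?case
      using psd_kernel.rank_one[of "\<lambda>x. f x * g x"] by (simp add: mult_ac)
  next
    case (add K L)
    then show ?case by (auto simp: distrib_left intro: psd_kernel.add)
  next
    case (limit K L)
    show ?case
      by (rule psd_kernel.limit[where K = "\<lambda>n x y. f x * f y * K n x y"])
        (intro limit.IH tendsto_intros limit.hyps)+
  qed
next
  case (add K L)
  then show ?case by (auto simp: distrib_right intro: psd_kernel.add)
next
  case (limit K K')
  show ?case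
    by (rule psd_kernel.limit[where K = "\<lambda>n x y. K n x y * L x y"])
      (intro limit.IH[OF limit.prems] tendsto_intros limit.hyps)+
qed

lemma psd_kernel_scale: "0 \<le> c \<Longrightarrow> psd_kernel K \<Longrightarrow> psd_kernel (\<lambda>x y. c * K x y)"
  using psd_kernel_mult[OF psd_kernel_const] .

lemma psd_kernel_power: "psd_kernel K \<Longrightarrow> psd_kernel (\<lambda>x y. K x y ^ n)"
  by (induction n) (auto intro: psd_kernel_const psd_kernel_mult)

lemma psd_kernel_sum:
  "(\<And>i. i \<in> I \<Longrightarrow> psd_kernel (K i)) \<Longrightarrow> psd_kernel (\<lambda>x y. \<Sum>i\<in>I. K i x y)"
  by (induction I rule: infinite_finite_induct) (auto intro: psd_kernel_const psd_kernel.add)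

text \<open>Partial sums of the series lie in the cone by the Schur product theorem. The series is
  available only inside the open interval, while the kernels of interest take the value 1 on the
  diagonal; so the kernel is first contracted by \<open>r n < 1\<close>, and then \<open>r n\<close>
  tends to 1, using continuity of \<open>arcsin\<close> on the closed interval.\<close>

lemma psd_kernel_arcsin:
  assumes "psd_kernel K" and bound: "\<And>x y. \<bar>K x y\<bar> \<le> 1"
  shows "psd_kernel (\<lambda>x y. arcsin (K x y))"
proof -
  obtain c where c: "\<And>n. 0 \<le> c n"
    and sums: "\<And>x. \<bar>x\<bar> < 1 \<Longrightarrow> (\<lambda>n. c n * x ^ n) sums arcsin x"
    using arcsin_power_series by blast
  define r where "r n = 1 - inverse (real (Suc n))" for n
  have r: "0 \<le> r n" "r n < 1" for n
    by (auto simp: r_def inverse_eq_divide field_simps)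
  have contraction: "psd_kernel (\<lambda>x y. arcsin (r n * K x y))" for n
  proof (rule psd_kernel.limit)
    show "psd_kernel (\<lambda>x y. \<Sum>i<k. c i * (r n * K x y) ^ i)" for k
      by (intro psd_kernel_sum psd_kernel_scale psd_kernel_power c r assms)
    have "\<bar>r n * K x y\<bar> < 1" for x y
      using mult_left_mono[OF bound[of x y], of "r n"] r[of n] by (simp add: abs_mult)
    then show "(\<lambda>k. \<Sum>i<k. c i * (r n * K x y) ^ i) \<longlonglongrightarrow> arcsin (r n * K x y)" for x y
      using sums unfolding sums_def by blast
  qed
  show ?thesis
  proof (rule psd_kernel.limit[OF contraction])
    fix x y
    have "r \<longlonglongrightarrow> 1 - 0"
      unfolding r_def by (intro tendsto_intros LIMSEQ_inverse_real_of_nat)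
    then have "(\<lambda>n. r n * K x y) \<longlonglongrightarrow> 1 * K x y"
      by (intro tendsto_intros) simp
    moreover have "\<bar>r n * K x y\<bar> \<le> 1" for n
      using mult_mono[of "r n" 1 "\<bar>K x y\<bar>" 1] bound[of x y] r[of n] by (simp add: abs_mult)
    then have "r n * K x y \<in> {-1..1}" for n
      by (simp add: abs_le_iff minus_le_iff)
    moreover have "K x y \<in> {-1..1}"
      using bound[of x y] by (simp add: abs_le_iff minus_le_iff)
    ultimately show "(\<lambda>n. arcsin (r n * K x y)) \<longlonglongrightarrow> arcsin (K x y)"
      using continuous_on_tendsto_compose[OF continuous_on_arcsin'] by force
  qed
qed

text \<open>A Hermitian matrix \<open>X + \<i>Y\<close> corresponds to the real block matrix
  \<open>[[X, -Y], [Y, X]]\<close>, whose blocks are indexed here by \<open>False\<close> and \<open>True\<close>.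
  For other real kernels, averaging the blocks projects onto this form.\<close>

definition complexify :: "('m \<times> bool \<Rightarrow> 'm \<times> bool \<Rightarrow> real) \<Rightarrow> complex^'m^'m" where
  "complexify K = (\<chi> i j. Complex ((K (i, False) (j, False) + K (i, True) (j, True)) / 2)
                                  ((K (i, True) (j, False) - K (i, False) (j, True)) / 2))"

lemma complexify_add: "complexify (\<lambda>x y. K x y + L x y) = complexify K + complexify L"
  by (simp add: complexify_def vec_eq_iff complex_eq_iff field_simps)

lemma tendsto_complexify:
  assumes "\<And>x y. (\<lambda>n. K n x y) \<longlonglongrightarrow> L x y"
  shows "(\<lambda>n. complexify (K n) $ i $ j) \<longlonglongrightarrow> complexify L $ i $ j"
  unfolding complexify_def vec_lambda_beta by (intro tendsto_intros assms) auto

text \<open>Symmetry of the kernel makes the real part symmetric and the imaginary part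
  antisymmetric.\<close>

lemma complexify_hermitian:
  assumes "psd_kernel K"
  shows "complexify K $ i $ j = cnj (complexify K $ j $ i)"
  using psd_kernel_sym[OF assms, of "(j, True)" "(i, False)"]
    psd_kernel_sym[OF assms, of "(j, False)" "(i, True)"]
    psd_kernel_sym[OF assms, of "(j, False)" "(i, False)"]
    psd_kernel_sym[OF assms, of "(j, True)" "(i, True)"]
  by (simp add: complexify_def complex_eq_iff field_simps)

lemma complexify_rank_one:
  "complexify (\<lambda>x y. f x * f y) $ i $ j =
     (Complex (f (i, False)) (f (i, True)) * cnj (Complex (f (j, False)) (f (j, True)))) / 2"
  by (simp add: complexify_def complex_eq_iff)

section \<open>The Frobenius inner product\<close>

definition frob :: "complex^'n^'m \<Rightarrow> complex^'n^'m \<Rightarrow> complex" where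
  "frob X Y = (\<Sum>i\<in>UNIV. \<Sum>j\<in>UNIV. cnj (X $ i $ j) * Y $ i $ j)"

lemma frob_add_right: "frob X (Y + Z) = frob X Y + frob X Z"
  by (simp add: frob_def distrib_left sum.distrib)

lemma frob_commute: "frob X Y = cnj (frob Y X)"
  by (simp add: frob_def mult.commute)

lemma matrix_add_rdistrib:
  fixes A B :: "'a::semiring_1^'n^'m"
  shows "(A + B) ** C = A ** C + B ** C"
  by (simp add: matrix_matrix_mult_def vec_eq_iff distrib_right sum.distrib)

text \<open>For rank-one kernels the two outer factors are \<open>u u^H / 2\<close> and
  \<open>v v^H / 2\<close>, and the value is \<open>|u^H E v|^2 / 4\<close>. The expression is
  additive and continuous in each outer factor, so a nested induction extends the bound to the cone
  without matrix square roots.\<close>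

lemma frob_sandwich_nonneg:
  assumes "psd_kernel K" "psd_kernel L"
  shows "0 \<le> Re (frob E (complexify K ** E ** complexify L))"
  using assms(1)
proof (induction rule: psd_kernel.induct)
  case (rank_one f)
  let ?f = "complexify (\<lambda>x y. f x * f y)"
  show ?case
    using assms(2)
  proof (induction rule: psd_kernel.induct)
    case (rank_one g)
    let ?g = "complexify (\<lambda>x y. g x * g y)"
    define u where "u i = Complex (f (i, False)) (f (i, True))" for i
    define v where "v i = Complex (g (i, False)) (g (i, True))" for i
    \<comment> \<open>The scalar \<open>u^H E v\<close>.\<close>
    define w where "w = (\<Sum>l\<in>UNIV. \<Sum>k\<in>UNIV. cnj (u k) * E $ k $ l * v l)"
    have entry: "(?f ** E ** ?g) $ i $ j = u i * cnj (v j) * w / 4" for i j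
      by (simp add: matrix_matrix_mult_def complexify_rank_one u_def v_def w_def
          sum_distrib_left sum_distrib_right sum_divide_distrib mult_ac)
    have cnj_w: "cnj w = (\<Sum>k\<in>UNIV. \<Sum>l\<in>UNIV. u k * cnj (E $ k $ l) * cnj (v l))"
      unfolding w_def by (subst sum.swap) simp
    have "frob E (?f ** E ** ?g) = cnj w * (w / 4)"
      unfolding frob_def entry cnj_w by (simp only: sum_distrib_right) (simp add: mult_ac)
    moreover have "0 \<le> Re (cnj w * (w / 4))"
      by simp
    ultimately show ?case by metis
  next
    case (add K L)
    then show ?case by (simp add: complexify_add matrix_add_ldistrib frob_add_right)
  next
    case (limit K L)
    have "(\<lambda>n. Re (frob E (?f ** E ** complexify (K n))))
        \<longlonglongrightarrow> Re (frob E (?f ** E ** complexify L))"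
      unfolding frob_def matrix_matrix_mult_def vec_lambda_beta
      by (intro tendsto_intros tendsto_complexify limit.hyps)
    then show ?case by (rule LIMSEQ_le_const) (use limit.IH in blast)
  qed
next
  case (add K L)
  then show ?case by (simp add: complexify_add matrix_add_rdistrib frob_add_right)
next
  case (limit K K')
  have "(\<lambda>n. Re (frob E (complexify (K n) ** E ** complexify L)))
      \<longlonglongrightarrow> Re (frob E (complexify K' ** E ** complexify L))"
    unfolding frob_def matrix_matrix_mult_def vec_lambda_beta
    by (intro tendsto_intros tendsto_complexify limit.hyps)
  then show ?case by (rule LIMSEQ_le_const) (use limit.IH in blast)
qed

subsection \<open>Complex matrices\<close>

lemma matrix_inv_inverse:
  fixes A :: "'a::field^'n^'n"
  assumes "invertible A"
  shows "A ** matrix_inv A = mat 1" "matrix_inv A ** A = mat 1"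
  using someI_ex[OF assms[unfolded invertible_def]] by (auto simp: matrix_inv_def)

lemma tendsto_det:
  fixes A :: "'b \<Rightarrow> 'a::real_normed_field^'n^'n"
  assumes "\<And>i j. ((\<lambda>x. A x $ i $ j) \<longlongrightarrow> L $ i $ j) F"
  shows "((\<lambda>x. det (A x)) \<longlongrightarrow> det L) F"
  unfolding det_def by (intro tendsto_intros assms)

text \<open>Column \<open>j\<close> of the inverse solves \<open>A x = axis j 1\<close>. As
  quotients of determinants, the entries of the inverse visibly depend continuously on those of
  \<open>A\<close>.\<close>

lemma matrix_inv_cramer:
  fixes A :: "'a::field^'n^'n"
  assumes "det A \<noteq> 0"
  shows "matrix_inv A $ k $ j = det (\<chi> i l. if l = k then axis j 1 $ i else A $ i $ l) / det A"
proof -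
  have "A *v column j (matrix_inv A) = axis j 1"
    using matrix_inv_inverse(1)[of A] assms
    by (simp add: invertible_det_nz vec_eq_iff matrix_matrix_mult_def matrix_vector_mult_def
        column_def mat_def axis_def)
  then have "column j (matrix_inv A) = (\<chi> k. det (\<chi> i l. if l = k then axis j 1 $ i else A $ i $ l) / det A)"
    using cramer[OF assms] by blast
  then show ?thesis
    by (simp add: vec_eq_iff column_def)
qed

lemma tendsto_matrix_inv:
  fixes A :: "'b \<Rightarrow> 'a::real_normed_field^'n^'n"
  assumes lim: "\<And>i j. ((\<lambda>x. A x $ i $ j) \<longlongrightarrow> L $ i $ j) F" and inv: "invertible L"
  shows "((\<lambda>x. matrix_inv (A x) $ k $ j) \<longlongrightarrow> matrix_inv L $ k $ j) F"
proof -
  have L: "det L \<noteq> 0"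
    using inv by (simp add: invertible_det_nz)
  have "((\<lambda>x. det (\<chi> i l. if l = k then axis j 1 $ i else A x $ i $ l) / det (A x))
      \<longlongrightarrow> det (\<chi> i l. if l = k then axis j 1 $ i else L $ i $ l) / det L) F"
    by (intro tendsto_divide tendsto_det L) (auto simp: lim)
  \<comment> \<open>Nonsingularity is an open condition, so Cramer's formula is eventually valid
    along the filter.\<close>
  moreover have "\<forall>\<^sub>F x in F. det (A x) \<noteq> 0"
    using tendsto_det[OF lim] L by (rule tendsto_imp_eventually_ne)
  ultimately show ?thesis
    unfolding matrix_inv_cramer[OF L]
    by (elim Lim_transform_eventually eventually_mono) (simp add: matrix_inv_cramer)
qed

section \<open>Hermitian forms and their inverses\<close>

definition hermitian :: "complex^'n^'n \<Rightarrow> bool" where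
  "hermitian A \<longleftrightarrow> (\<forall>i j. A $ i $ j = cnj (A $ j $ i))"

definition cdot :: "complex^'n \<Rightarrow> complex^'n \<Rightarrow> complex" where
  "cdot x y = (\<Sum>i\<in>UNIV. cnj (x $ i) * y $ i)"

lemma cdot_add_left: "cdot (x + y) z = cdot x z + cdot y z"
  by (simp add: cdot_def algebra_simps sum.distrib)

lemma cdot_add_right: "cdot z (x + y) = cdot z x + cdot z y"
  by (simp add: cdot_def algebra_simps sum.distrib)

lemma cdot_scale_left: "cdot (c *s x) z = cnj c * cdot x z"
  by (simp add: cdot_def sum_distrib_left mult_ac)

lemma cdot_scale_right: "cdot z (c *s x) = c * cdot z x"
  by (simp add: cdot_def sum_distrib_left mult_ac)

lemma cdot_commute: "cdot x y = cnj (cdot y x)"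
  by (simp add: cdot_def mult.commute)

lemma cdot_hermitian:
  assumes "hermitian A"
  shows "cdot (A *v x) y = cdot x (A *v y)"
proof -
  have A: "cnj (A $ i $ j) = A $ j $ i" for i j
    using assms by (metis hermitian_def)
  have "cdot (A *v x) y = (\<Sum>i\<in>UNIV. \<Sum>j\<in>UNIV. A $ j $ i * cnj (x $ j) * y $ i)"
    by (simp add: cdot_def matrix_vector_mult_def sum_distrib_right A)
  also have "\<dots> = cdot x (A *v y)"
    unfolding cdot_def matrix_vector_mult_def
    by (subst sum.swap) (simp add: sum_distrib_left mult_ac)
  finally show ?thesis .
qed

lemma cdot_self_eq_0_iff: "Re (cdot x x) = 0 \<longleftrightarrow> x = 0"
proof -
  have "Re (cdot x x) = (\<Sum>i\<in>UNIV. (cmod (x $ i))\<^sup>2)"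
    by (simp add: cdot_def cmod_power2) (simp add: power2_eq_square)
  then show ?thesis
    by (simp add: sum_nonneg_eq_0_iff vec_eq_iff)
qed

text \<open>A zero of a nonnegative form is a minimum. Moving from \<open>y\<close> in the direction
  \<open>z = A y\<close> gives the real quadratic \<open>2 t |z|^2 + t^2 b\<close>, and its
  nonnegativity for all \<open>t\<close> forces \<open>z = 0\<close>.\<close>

lemma hermitian_psd_null:
  assumes herm: "hermitian A" and psd: "\<And>x. 0 \<le> Re (cdot x (A *v x))"
    and null: "Re (cdot y (A *v y)) = 0"
  shows "A *v y = 0"
proof -
  define z where "z = A *v y"
  define a where "a = Re (cdot z z)"
  define b where "b = Re (cdot z (A *v z))"
  have expand: "0 \<le> 2 * t * a + t\<^sup>2 * b" for t
  proof -
    let ?s = "complex_of_real t"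
    have "cdot (y + ?s *s z) (A *v (y + ?s *s z)) =
        cdot y (A *v y) + ?s * cdot z z + ?s * cdot y (A *v z) + ?s\<^sup>2 * cdot z (A *v z)"
      by (simp add: matrix_vector_right_distrib vector_scalar_commute cdot_add_left cdot_add_right
          cdot_scale_left cdot_scale_right z_def[symmetric] power2_eq_square algebra_simps)
    moreover have "cdot y (A *v z) = cdot z z"
      using cdot_hermitian[OF herm, of y z] by (simp add: z_def)
    ultimately have "Re (cdot (y + ?s *s z) (A *v (y + ?s *s z))) = 2 * t * a + t\<^sup>2 * b"
      using null by (simp add: a_def b_def flip: of_real_power)
    then show ?thesis using psd by metis
  qed
  have "b \<ge> 0" using psd by (simp add: b_def)
  \<comment> \<open>For \<open>b = 0\<close> the expression is linear in \<open>t\<close>, so both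
    signs of \<open>t\<close> decide; otherwise its minimum, at \<open>t = - a / b\<close>, is
    \<open>- a^2 / b\<close>.\<close>
  have "a = 0"
  proof (cases "b = 0")
    case True
    then show ?thesis using expand[of 1] expand[of "-1"] by simp
  next
    case False
    then have "0 \<le> - a\<^sup>2 / b"
      using expand[of "- a / b"] by (simp add: power2_eq_square field_simps)
    then show ?thesis
      using False \<open>b \<ge> 0\<close> by (auto simp: zero_le_divide_iff divide_le_0_iff)
  qed
  then show ?thesis
    by (simp add: a_def z_def cdot_self_eq_0_iff)
qed

text \<open>Evaluating self-adjointness of \<open>A\<close> at \<open>B x\<close> and
  \<open>B y\<close> yields self-adjointness of \<open>B\<close>; basis vectors then recover the
  entries.\<close>

lemma hermitian_matrix_inv:
  assumes "hermitian A" "invertible A"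
  shows "hermitian (matrix_inv A)"
proof -
  define B where "B = matrix_inv A"
  have AB: "A *v (B *v x) = x" for x
    using matrix_inv_inverse(1)[OF assms(2)] by (simp add: B_def matrix_vector_mul_assoc)
  have entry: "B $ i $ j = cdot (axis i 1) (B *v axis j 1)" for i j
    by (simp add: cdot_def axis_def matrix_vector_mult_def if_distrib if_distribR cong: if_cong)
  have "cdot x (B *v y) = cnj (cdot y (B *v x))" for x y
    using cdot_hermitian[OF assms(1), of "B *v x" "B *v y"] cdot_commute[of y "B *v x"]
    by (simp add: AB)
  then show ?thesis
    unfolding hermitian_def B_def[symmetric] entry by blast
qed

text \<open>With \<open>x = A y\<close> the form of the inverse at \<open>x\<close> is the conjugate
  of the form of \<open>A\<close> at \<open>y\<close>. It cannot vanish, since then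
  \<open>x = A y = 0\<close>.\<close>

lemma posdef_matrix_inv:
  assumes herm: "hermitian A" and inv: "invertible A"
    and psd: "\<And>x. 0 \<le> Re (cdot x (A *v x))" and "x \<noteq> 0"
  shows "0 < Re (cdot x (matrix_inv A *v x))"
proof -
  define y where "y = matrix_inv A *v x"
  have Ay: "A *v y = x"
    using matrix_inv_inverse(1)[OF inv] by (simp add: y_def matrix_vector_mul_assoc)
  have "cdot x (matrix_inv A *v x) = cnj (cdot y (A *v y))"
    using cdot_commute[of x y] by (simp add: Ay flip: y_def)
  moreover have "Re (cdot y (A *v y)) \<noteq> 0"
    using hermitian_psd_null[OF herm psd] Ay \<open>x \<noteq> 0\<close> by metis
  ultimately show ?thesis
    using psd[of y] by simp
qed

text \<open>Padding a vector with zeros turns the form of the block into the form of the whole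
  inverse.\<close>

lemma posdef_matrix_inv_block:
  fixes A :: "complex^('k::finite + 'l::finite)^('k + 'l)"
  assumes "hermitian A" "invertible A" "\<And>x. 0 \<le> Re (cdot x (A *v x))"
  shows "posdef (\<chi> i j. matrix_inv A $ Inl i $ Inl j)"
  unfolding posdef_def
proof (intro conjI allI impI)
  fix i j
  show "(\<chi> i j. matrix_inv A $ Inl i $ Inl j) $ i $ j
      = cnj ((\<chi> i j. matrix_inv A $ Inl i $ Inl j) $ j $ i)"
    using hermitian_matrix_inv[OF assms(1,2)] unfolding hermitian_def vec_lambda_beta by blast
next
  fix x :: "complex^'k"
  assume "x \<noteq> 0"
  define y :: "complex^('k + 'l)" where "y = (\<chi> l. case l of Inl k \<Rightarrow> x $ k | Inr k \<Rightarrow> 0)"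
  have split: "(\<Sum>l\<in>UNIV. f l) = (\<Sum>k\<in>UNIV. f (Inl k)) + (\<Sum>k\<in>UNIV. f (Inr k))"
    for f :: "'k + 'l \<Rightarrow> complex"
    by (subst UNIV_Plus_UNIV[symmetric], subst sum.Plus) auto
  have "y $ Inl k = x $ k" for k
    by (simp add: y_def)
  then have "y \<noteq> 0"
    using \<open>x \<noteq> 0\<close> by (metis vec_eq_iff zero_index)
  then have "0 < Re (cdot y (matrix_inv A *v y))"
    using posdef_matrix_inv assms by blast
  then show "0 < Re (\<Sum>i\<in>UNIV. cnj (x $ i) * ((\<chi> i j. matrix_inv A $ Inl i $ Inl j) *v x) $ i)"
    by (simp add: cdot_def matrix_vector_mult_def split y_def)
qed

section \<open>The quadratic form of the Fisher matrix\<close>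

text \<open>Cyclicity of the trace, carried out as a relabelling of the four summation
  indices.\<close>

lemma frob_sandwich_hermitian:
  fixes A :: "complex^'m^'m"
  assumes "hermitian A"
  shows "frob X (A ** Y ** A) = frob (A ** X ** A) Y"
proof -
  have A: "cnj (A $ i $ j) = A $ j $ i" for i j
    using assms by (metis hermitian_def)
  have "frob X (A ** Y ** A) = (\<Sum>i\<in>UNIV. \<Sum>j\<in>UNIV. \<Sum>l\<in>UNIV. \<Sum>k\<in>UNIV.
      cnj (X $ i $ j) * A $ i $ k * Y $ k $ l * A $ l $ j)"
    by (simp add: frob_def matrix_matrix_mult_def sum_distrib_left sum_distrib_right mult_ac)
  also have "\<dots> = (\<Sum>k\<in>UNIV. \<Sum>l\<in>UNIV. \<Sum>j\<in>UNIV. \<Sum>i\<in>UNIV.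
      cnj (X $ i $ j) * A $ i $ k * Y $ k $ l * A $ l $ j)"
    unfolding sum.cartesian_product
    by (rule sum.reindex_bij_witness[where i = "\<lambda>(k, l, j, i). (i, j, l, k)"
          and j = "\<lambda>(k, l, j, i). (i, j, l, k)"]) auto
  also have "\<dots> = frob (A ** X ** A) Y"
    by (simp add: frob_def matrix_matrix_mult_def A sum_distrib_left sum_distrib_right mult_ac)
  finally show ?thesis .
qed

text \<open>The identity \<open>vec (A X B) = kron (transpose B) A vec X\<close> at
  \<open>B = A\<close>; the pairs (column, row) of \<open>vecm\<close> match the factor order of
  \<open>kron\<close>.\<close>

lemma kron_vecm:
  fixes A :: "complex^'m^'m"
  shows "kron (transpose A) A *v vecm X = vecm (A ** X ** A)"
proof -
  have "(\<Sum>p\<in>UNIV. kron (transpose A) A $ (j, i) $ p * vecm X $ p) = (A ** X ** A) $ i $ j" for i j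
  proof -
    have "(\<Sum>p\<in>UNIV. kron (transpose A) A $ (j, i) $ p * vecm X $ p)
        = (\<Sum>l\<in>UNIV. \<Sum>k\<in>UNIV. A $ l $ j * A $ i $ k * X $ k $ l)"
      by (simp add: kron_def vecm_def transpose_def sum.cartesian_product case_prod_unfold)
    then show ?thesis
      by (simp add: matrix_matrix_mult_def sum_distrib_left sum_distrib_right mult_ac)
  qed
  then show ?thesis
    by (auto simp: vec_eq_iff matrix_vector_mult_def vecm_def)
qed

lemma frob_vecm: "(\<Sum>q\<in>UNIV. cnj (vecm X $ q) * vecm Y $ q) = frob X Y"
proof -
  have "(\<Sum>q\<in>UNIV. cnj (vecm X $ q) * vecm Y $ q)
      = (\<Sum>j\<in>UNIV. \<Sum>i\<in>UNIV. cnj (X $ i $ j) * Y $ i $ j)"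
    by (simp add: vecm_def sum.cartesian_product case_prod_unfold)
  also have "\<dots> = frob X Y"
    unfolding frob_def by (rule sum.swap)
  finally show ?thesis .
qed

lemma FIMw_eq_frob:
  "FIMw pos N rho $ a $ b = of_nat N *
     frob (dRx pos rho a) (matrix_inv (Rx pos rho) ** dRx pos rho b ** matrix_inv (Rx pos rho))"
  by (simp add: FIMw_def Let_def kron_vecm frob_vecm)

lemma hermitian_FIMw:
  assumes "hermitian (Rx pos rho)" "invertible (Rx pos rho)"
  shows "hermitian (FIMw pos N rho)"
  using frob_sandwich_hermitian[OF hermitian_matrix_inv[OF assms]]
  unfolding hermitian_def FIMw_eq_frob
  by (metis complex_cnj_mult complex_cnj_of_nat frob_commute)

text \<open>By sesquilinearity the form is \<open>N tr (D^H B D B)\<close> with \<open>D\<close> the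
  combination of derivative matrices weighted by \<open>x\<close>. The cone representation is known
  for \<open>Rx\<close> and not for its inverse \<open>B\<close>; substituting
  \<open>D = R E R\<close> moves the expression to \<open>Rx\<close>.\<close>

lemma FIMw_psd:
  fixes pos :: "'m::finite \<Rightarrow> int" and rho :: "real^('k::finite + 'k)"
  assumes R: "Rx pos rho = complexify K" and K: "psd_kernel K" and inv: "invertible (Rx pos rho)"
  shows "0 \<le> Re (cdot x (FIMw pos N rho *v x))"
proof -
  define B where "B = matrix_inv (Rx pos rho)"
  define D :: "complex^'m^'m" where "D = (\<chi> i j. \<Sum>a\<in>UNIV. x $ a * dRx pos rho a $ i $ j)"
  define E where "E = B ** D ** B"
  have herm: "hermitian (Rx pos rho)"
    unfolding hermitian_def R using complexify_hermitian[OF K] by blast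
  have "Rx pos rho ** E ** Rx pos rho = (Rx pos rho ** B) ** D ** (B ** Rx pos rho)"
    by (simp add: E_def matrix_mul_assoc)
  also have "\<dots> = D"
    using matrix_inv_inverse[OF inv] by (simp add: B_def)
  finally have D: "D = Rx pos rho ** E ** Rx pos rho" ..
  have BDB: "(B ** D ** B) $ i $ j = (\<Sum>b\<in>UNIV. x $ b * (B ** dRx pos rho b ** B) $ i $ j)" for i j
  proof -
    have "(B ** D ** B) $ i $ j =
        (\<Sum>l\<in>UNIV. \<Sum>k\<in>UNIV. \<Sum>b\<in>UNIV. x $ b * (B $ i $ k * dRx pos rho b $ k $ l * B $ l $ j))"
      by (simp add: D_def matrix_matrix_mult_def sum_distrib_left sum_distrib_right mult_ac)
    also have "\<dots> = (\<Sum>b\<in>UNIV. \<Sum>l\<in>UNIV. \<Sum>k\<in>UNIV. x $ b * (B $ i $ k * dRx pos rho b $ k $ l * B $ l $ j))"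
      unfolding sum.cartesian_product
      by (rule sum.reindex_bij_witness[where i = "\<lambda>(b, l, k). (l, k, b)"
            and j = "\<lambda>(l, k, b). (b, l, k)"]) auto
    finally show ?thesis
      by (simp add: matrix_matrix_mult_def sum_distrib_left sum_distrib_right mult_ac)
  qed
  have "cdot x (FIMw pos N rho *v x) = of_nat N *
      (\<Sum>a\<in>UNIV. \<Sum>b\<in>UNIV. \<Sum>i\<in>UNIV. \<Sum>j\<in>UNIV.
        cnj (x $ a) * x $ b * (cnj (dRx pos rho a $ i $ j) * (B ** dRx pos rho b ** B) $ i $ j))"
    by (simp add: cdot_def matrix_vector_mult_def FIMw_eq_frob frob_def B_def[symmetric]
        sum_distrib_left sum_distrib_right mult_ac)
  also have "\<dots> = of_nat N * (\<Sum>i\<in>UNIV. \<Sum>j\<in>UNIV. \<Sum>b\<in>UNIV. \<Sum>a\<in>UNIV.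
        cnj (x $ a) * x $ b * (cnj (dRx pos rho a $ i $ j) * (B ** dRx pos rho b ** B) $ i $ j))"
    unfolding sum.cartesian_product
    by (rule arg_cong[where f = "(*) (of_nat N)"],
        rule sum.reindex_bij_witness[where i = "\<lambda>(i, j, b, a). (a, b, i, j)"
          and j = "\<lambda>(a, b, i, j). (i, j, b, a)"]) auto
  also have "\<dots> = of_nat N * frob D (B ** D ** B)"
    unfolding frob_def BDB by (simp add: D_def sum_distrib_left sum_distrib_right mult_ac)
  also have "frob D (B ** D ** B) = frob E (complexify K ** E ** complexify K)"
    unfolding D[symmetric] R[symmetric] using frob_sandwich_hermitian[OF herm, of E E]
    by (simp flip: D) (simp add: E_def)
  finally show ?thesis
    using frob_sandwich_nonneg[OF K K, of E] by simp
qed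

subsection \<open>The one-bit covariance matrix\<close>

lemma steer_mult_cnj:
  "steer pos th $ i * cnj (steer pos th $ j) = cis (pi * sin th * of_int (pos i - pos j))"
  by (simp add: steer_def cis_cnj cis_mult right_diff_distrib)

lemma norm_steer [simp]: "cmod (steer pos th $ i) = 1"
  by (simp add: steer_def)

section \<open>Partial derivatives of the covariance entries\<close>

text \<open>With \<open>d\<close> a difference of sensor positions, \<open>h = cos\<close> and
  \<open>h = sin\<close> give the real and the imaginary part of an off-diagonal entry of
  \<open>Rbar\<close>; keeping \<open>h\<close> abstract treats both at once.\<close>

definition phase_sum :: "(real \<Rightarrow> real) \<Rightarrow> real \<Rightarrow> real^('k::finite + 'k) \<Rightarrow> real" where
  "phase_sum h d rho = (\<Sum>k\<in>UNIV. rho $ Inr k * h (pi * sin (rho $ Inl k) * d))"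

text \<open>The partial derivative in coordinate \<open>n\<close> when \<open>h'\<close> is the
  derivative of \<open>h\<close>: the chain rule for an angle, linearity for a power.\<close>

definition phase_sum_deriv ::
    "(real \<Rightarrow> real) \<Rightarrow> (real \<Rightarrow> real) \<Rightarrow> real \<Rightarrow> real^('k::finite + 'k) \<Rightarrow> 'k + 'k \<Rightarrow> real" where
  "phase_sum_deriv h h' d rho n = (case n of
      Inl k \<Rightarrow> rho $ Inr k * (h' (pi * sin (rho $ Inl k) * d) * (pi * cos (rho $ Inl k) * d))
    | Inr k \<Rightarrow> h (pi * sin (rho $ Inl k) * d))"

text \<open>The source powers and the noise share always add up to 1.\<close>

lemma Rbar_diag: "Rbar pos rho $ i $ i = 1"
proof -
  have "steer pos th $ i * cnj (steer pos th $ i) = 1" for th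
    by (simp add: steer_mult_cnj)
  then show ?thesis
    by (simp add: Rbar_def mult.assoc)
qed

lemma Rbar_offdiag:
  assumes "i \<noteq> j"
  shows "Rbar pos rho $ i $ j =
    Complex (phase_sum cos (of_int (pos i - pos j)) rho) (phase_sum sin (of_int (pos i - pos j)) rho)"
  using assms by (simp add: Rbar_def mult.assoc steer_mult_cnj phase_sum_def complex_eq_iff)

lemma DERIV_phase_sum:
  fixes rho :: "real^('k::finite + 'k)"
  assumes h: "\<And>x. (h has_real_derivative h' x) (at x)"
  shows "((\<lambda>t. phase_sum h d (\<chi> l. if l = n then t else rho $ l))
           has_real_derivative phase_sum_deriv h h' d rho n) (at (rho $ n))"
proof -
  \<comment> \<open>Only the source to which coordinate \<open>n\<close> belongs contributes, so the
    sum over \<open>k\<close> collapses to one term.\<close>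
  define D where "D k = (case n of
      Inl k' \<Rightarrow> if k' = k then phase_sum_deriv h h' d rho n else 0
    | Inr k' \<Rightarrow> if k' = k then phase_sum_deriv h h' d rho n else 0)" for k
  note h' = DERIV_chain2[OF h]
  have "((\<lambda>t. (\<chi> l. if l = n then t else rho $ l) $ Inr k *
      h (pi * sin ((\<chi> l. if l = n then t else rho $ l) $ Inl k) * d)) has_real_derivative D k)
      (at (rho $ n))" for k
    by (cases n) (auto simp: D_def phase_sum_deriv_def intro!: derivative_eq_intros h')
  then have "((\<lambda>t. phase_sum h d (\<chi> l. if l = n then t else rho $ l)) has_real_derivative
      (\<Sum>k\<in>UNIV. D k)) (at (rho $ n))"
    unfolding phase_sum_def by (intro DERIV_sum)
  also have "(\<Sum>k\<in>UNIV. D k) = phase_sum_deriv h h' d rho n"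
    by (cases n) (simp_all add: D_def)
  finally show ?thesis .
qed

lemma tendsto_phase_sum:
  assumes "(r \<longlongrightarrow> rho) F" and "\<And>x. isCont h x"
  shows "((\<lambda>x. phase_sum h d (r x)) \<longlongrightarrow> phase_sum h d rho) F"
  unfolding phase_sum_def
  by (intro tendsto_sum tendsto_mult tendsto_const tendsto_vec_nth assms(1)
      isCont_tendsto_compose[OF assms(2)] isCont_tendsto_compose[OF isCont_sin])

lemma tendsto_phase_sum_deriv:
  assumes "(r \<longlongrightarrow> rho) F" and "\<And>x. isCont h x" "\<And>x. isCont h' x"
  shows "((\<lambda>x. phase_sum_deriv h h' d (r x) n) \<longlongrightarrow> phase_sum_deriv h h' d rho n) F"
  unfolding phase_sum_deriv_def
  by (cases n; simp only: sum.case; intro tendsto_mult tendsto_const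
      tendsto_vec_nth assms(1) isCont_tendsto_compose[OF assms(2)] isCont_tendsto_compose[OF assms(3)]
      isCont_tendsto_compose[OF isCont_sin] isCont_tendsto_compose[OF isCont_cos])

lemma Rx_diag: "Rx pos rho $ i $ i = 1"
  by (simp add: Rx_def Rbar_diag casin_def flip: of_real_mult)

text \<open>The diagonal of \<open>Rbar\<close> sits at 1, where \<open>arcsin\<close> is not
  differentiable, but the composite is constant in the parameters.\<close>

lemma dRx_diag: "dRx pos rho n $ i $ i = 0"
  by (simp add: dRx_def Rx_diag)

lemma dRx_offdiag:
  fixes pos :: "'m::finite \<Rightarrow> int" and rho :: "real^('k::finite + 'k)"
  assumes "i \<noteq> j"
    and re: "\<bar>Re (Rbar pos rho $ i $ j)\<bar> < 1" and im: "\<bar>Im (Rbar pos rho $ i $ j)\<bar> < 1"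
  defines "d \<equiv> of_int (pos i - pos j)"
  shows "dRx pos rho n $ i $ j = complex_of_real (2 / pi) *
    Complex (inverse (sqrt (1 - (phase_sum cos d rho)\<^sup>2)) * phase_sum_deriv cos (\<lambda>x. - sin x) d rho n)
            (inverse (sqrt (1 - (phase_sum sin d rho)\<^sup>2)) * phase_sum_deriv sin cos d rho n)"
proof -
  define upd where "upd t = (\<chi> l. if l = n then t else rho $ l)" for t
  have upd: "upd (rho $ n) = rho"
    by (simp add: upd_def vec_eq_iff)
  have arcsin_deriv: "((\<lambda>t. arcsin (phase_sum h d (upd t))) has_real_derivative
      inverse (sqrt (1 - (phase_sum h d rho)\<^sup>2)) * phase_sum_deriv h h' d rho n) (at (rho $ n))"
    if "\<bar>phase_sum h d rho\<bar> < 1" "\<And>x. (h has_real_derivative h' x) (at x)" for h h'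
  proof (rule DERIV_chain2[where f = arcsin and g = "\<lambda>t. phase_sum h d (upd t)"])
    show "((\<lambda>t. phase_sum h d (upd t)) has_real_derivative phase_sum_deriv h h' d rho n) (at (rho $ n))"
      unfolding upd_def by (rule DERIV_phase_sum[OF that(2)])
    show "(arcsin has_real_derivative inverse (sqrt (1 - (phase_sum h d rho)\<^sup>2)))
        (at (phase_sum h d (upd (rho $ n))))"
      unfolding upd using that(1) by (intro DERIV_arcsin) auto
  qed
  have re': "\<bar>phase_sum cos d rho\<bar> < 1" and im': "\<bar>phase_sum sin d rho\<bar> < 1"
    using re im by (simp_all add: Rbar_offdiag[OF \<open>i \<noteq> j\<close>] d_def)
  have "((\<lambda>t. complex_of_real (2 / pi) * (complex_of_real (arcsin (phase_sum cos d (upd t))) +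
        \<i> * complex_of_real (arcsin (phase_sum sin d (upd t))))) has_vector_derivative
      complex_of_real (2 / pi) *
      (of_real (inverse (sqrt (1 - (phase_sum cos d rho)\<^sup>2)) * phase_sum_deriv cos (\<lambda>x. - sin x) d rho n) +
       \<i> * of_real (inverse (sqrt (1 - (phase_sum sin d rho)\<^sup>2)) * phase_sum_deriv sin cos d rho n)))
      (at (rho $ n))"
    by (intro has_vector_derivative_mult_right has_vector_derivative_add has_vector_derivative_of_real
        arcsin_deriv re' im' DERIV_cos DERIV_sin)
  moreover have "Rx pos (upd t) $ i $ j = complex_of_real (2 / pi) *
      (complex_of_real (arcsin (phase_sum cos d (upd t))) +
        \<i> * complex_of_real (arcsin (phase_sum sin d (upd t))))" for t
    by (simp add: Rx_def casin_def Rbar_offdiag[OF \<open>i \<noteq> j\<close>] d_def)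
  ultimately show ?thesis
    by (simp add: dRx_def flip: upd_def) (simp add: vector_derivative_at Complex_eq)
qed

section \<open>Continuity of the Fisher matrix\<close>

lemma tendsto_Rx:
  assumes r: "(r \<longlongrightarrow> rho) F"
    and interior: "\<And>i j. i \<noteq> j \<Longrightarrow> \<bar>Re (Rbar pos rho $ i $ j)\<bar> < 1 \<and> \<bar>Im (Rbar pos rho $ i $ j)\<bar> < 1"
  shows "((\<lambda>x. Rx pos (r x) $ i $ j) \<longlongrightarrow> Rx pos rho $ i $ j) F"
proof (cases "i = j")
  case True
  then show ?thesis by (simp add: Rx_diag)
next
  case False
  let ?d = "of_int (pos i - pos j)"
  have "isCont arcsin (phase_sum cos ?d rho)" "isCont arcsin (phase_sum sin ?d rho)"
    using interior[OF False] by (auto simp: Rbar_offdiag[OF False] intro!: isCont_arcsin)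
  then show ?thesis
    unfolding Rx_def casin_def vec_lambda_beta Rbar_offdiag[OF False] complex.sel
    by (intro tendsto_intros isCont_tendsto_compose[of _ arcsin] tendsto_phase_sum r) auto
qed

text \<open>The explicit formula \<open>G\<close> is continuous, but it equals the derivative only
  where both phase sums have modulus below 1. This condition is open, so it holds eventually along
  the filter.\<close>

lemma tendsto_dRx:
  fixes r :: "'b \<Rightarrow> real^('k::finite + 'k)"
  assumes r: "(r \<longlongrightarrow> rho) F"
    and interior: "\<And>i j. i \<noteq> j \<Longrightarrow> \<bar>Re (Rbar pos rho $ i $ j)\<bar> < 1 \<and> \<bar>Im (Rbar pos rho $ i $ j)\<bar> < 1"
  shows "((\<lambda>x. dRx pos (r x) n $ i $ j) \<longlongrightarrow> dRx pos rho n $ i $ j) F"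
proof (cases "i = j")
  case True
  then show ?thesis by (simp add: dRx_diag)
next
  case False
  define d :: real where "d = of_int (pos i - pos j)"
  define G where "G rho = complex_of_real (2 / pi) *
    Complex (inverse (sqrt (1 - (phase_sum cos d rho)\<^sup>2)) * phase_sum_deriv cos (\<lambda>x. - sin x) d rho n)
            (inverse (sqrt (1 - (phase_sum sin d rho)\<^sup>2)) * phase_sum_deriv sin cos d rho n)"
    for rho :: "real^('k + 'k)"
  have bound: "\<bar>phase_sum cos d rho\<bar> < 1" "\<bar>phase_sum sin d rho\<bar> < 1"
    using interior[OF False] by (auto simp: Rbar_offdiag[OF False] d_def)
  have lim: "((\<lambda>x. phase_sum cos d (r x)) \<longlongrightarrow> phase_sum cos d rho) F"
      "((\<lambda>x. phase_sum sin d (r x)) \<longlongrightarrow> phase_sum sin d rho) F"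
    by (intro tendsto_phase_sum r; simp)+
  have "\<forall>\<^sub>F x in F. \<bar>phase_sum cos d (r x)\<bar> < 1 \<and> \<bar>phase_sum sin d (r x)\<bar> < 1"
    using order_tendstoD(2)[OF tendsto_rabs[OF lim(1)] bound(1)]
      order_tendstoD(2)[OF tendsto_rabs[OF lim(2)] bound(2)] by (rule eventually_conj)
  then have "\<forall>\<^sub>F x in F. G (r x) = dRx pos (r x) n $ i $ j"
    by eventually_elim
      (simp add: G_def d_def dRx_offdiag[OF False] Rbar_offdiag[OF False])
  moreover have "((\<lambda>x. G (r x)) \<longlongrightarrow> G rho) F"
    unfolding G_def
  proof (intro tendsto_intros lim tendsto_phase_sum_deriv r)
    show "sqrt (1 - (phase_sum cos d rho)\<^sup>2) \<noteq> 0" "sqrt (1 - (phase_sum sin d rho)\<^sup>2) \<noteq> 0"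
      using bound by (simp_all flip: abs_square_less_1)
  qed auto
  moreover have "G rho = dRx pos rho n $ i $ j"
    using bound by (simp add: G_def d_def dRx_offdiag[OF False] Rbar_offdiag[OF False])
  ultimately show ?thesis
    by (simp add: Lim_transform_eventually)
qed

lemma tendsto_FIMw:
  assumes "(r \<longlongrightarrow> rho) F"
    and "\<And>i j. i \<noteq> j \<Longrightarrow> \<bar>Re (Rbar pos rho $ i $ j)\<bar> < 1 \<and> \<bar>Im (Rbar pos rho $ i $ j)\<bar> < 1"
    and "invertible (Rx pos rho)"
  shows "((\<lambda>x. FIMw pos N (r x) $ a $ b) \<longlongrightarrow> FIMw pos N rho $ a $ b) F"
  unfolding FIMw_eq_frob frob_def matrix_matrix_mult_def vec_lambda_beta
  by (intro tendsto_intros tendsto_matrix_inv tendsto_Rx tendsto_dRx assms)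

section \<open>The limit point, where the normalized powers sum to 1\<close>

text \<open>The noise term vanishes, leaving a convex combination of complex numbers of modulus
  1.\<close>

lemma norm_Rbar_le_1:
  assumes "\<And>k. 0 \<le> rho $ Inr k" "(\<Sum>k\<in>UNIV. rho $ Inr k) = 1"
  shows "cmod (Rbar pos rho $ i $ j) \<le> 1"
proof -
  have "Rbar pos rho $ i $ j = (\<Sum>k\<in>UNIV. complex_of_real (rho $ Inr k) *
      steer pos (rho $ Inl k) $ i * cnj (steer pos (rho $ Inl k) $ j))"
    using assms by (simp add: Rbar_def)
  also have "cmod \<dots> \<le> (\<Sum>k\<in>UNIV. rho $ Inr k)"
    using assms(1) by (intro sum_norm_le) (simp add: norm_mult)
  finally show ?thesis using assms by simp
qed

text \<open>Multiplication by \<open>u\<close> only swaps real and imaginary part up to sign, and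
  \<open>arcsin\<close> is odd on [-1, 1].\<close>

lemma casin_mult_fourth_root_of_unity:
  assumes "u \<in> {1, -1, \<i>, -\<i>}" "\<bar>Re z\<bar> \<le> 1" "\<bar>Im z\<bar> \<le> 1"
  shows "casin (u * z) = u * casin z"
  using assms by (auto simp: casin_def complex_eq_iff arcsin_minus abs_le_iff)

text \<open>If a real or imaginary part has modulus 1, all summands of that entry of \<open>Rbar\<close> equal one
  fourth root of unity \<open>u\<close>. Since \<open>casin\<close> commutes with multiplication by \<open>u\<close>, two rows of
  \<open>Rx\<close> are then proportional.\<close>

lemma Rbar_offdiag_interior:
  assumes pos: "\<And>k. 0 < rho $ Inr k" and sum: "(\<Sum>k\<in>UNIV. rho $ Inr k) = 1"
    and inv: "invertible (Rx pos rho)" and "i \<noteq> j"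
  shows "\<bar>Re (Rbar pos rho $ i $ j)\<bar> < 1 \<and> \<bar>Im (Rbar pos rho $ i $ j)\<bar> < 1"
proof (rule ccontr)
  assume boundary: "\<not> ?thesis"
  define z where "z = Rbar pos rho $ i $ j"
  \<comment> \<open>The factor \<open>cnj u\<close> rotates the extremal real or imaginary part onto
    the positive real axis.\<close>
  have "\<exists>u\<in>{1, -1, \<i>, -\<i>}. 1 \<le> Re (cnj u * z)"
    using boundary by (auto simp: z_def abs_less_iff)
  then obtain u where u: "u \<in> {1, -1, \<i>, -\<i>}" and Re_u: "1 \<le> Re (cnj u * z)"
    by blast
  have u_unit: "u * cnj u = 1" "cmod u = 1"
    using u by auto
  define w where "w k = cnj u * (steer pos (rho $ Inl k) $ i * cnj (steer pos (rho $ Inl k) $ j))" for k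
  have w_norm: "cmod (w k) = 1" for k
    by (simp add: w_def norm_mult u_unit)
  then have w_le: "Re (w k) \<le> 1" for k
    by (metis complex_Re_le_cmod)
  have "Re (cnj u * z) = (\<Sum>k\<in>UNIV. rho $ Inr k * Re (w k))"
  proof -
    have "cnj u * z = (\<Sum>k\<in>UNIV. complex_of_real (rho $ Inr k) * w k)"
      using \<open>i \<noteq> j\<close> by (simp add: z_def Rbar_def w_def sum_distrib_left mult_ac)
    then show ?thesis by simp
  qed
  \<comment> \<open>An average with positive weights of numbers at most 1 can reach 1 only if each
    of them is 1.\<close>
  then have "(\<Sum>k\<in>UNIV. rho $ Inr k * (1 - Re (w k))) \<le> 0"
    using Re_u sum by (simp add: right_diff_distrib sum_subtractf)
  moreover have nonneg: "0 \<le> rho $ Inr k * (1 - Re (w k))" for k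
    using pos[of k] w_le[of k] by simp
  ultimately have "(\<Sum>k\<in>UNIV. rho $ Inr k * (1 - Re (w k))) = 0"
    by (meson antisym sum_nonneg)
  then have "rho $ Inr k * (1 - Re (w k)) = 0" for k
    using nonneg by (simp add: sum_nonneg_eq_0_iff)
  then have "Re (w k) = 1" for k
    using pos[of k] by (metis less_numeral_extra(3) mult_eq_0_iff right_minus_eq)
  then have "w k = 1" for k
    using w_norm[of k] by (simp add: complex_eq_iff cmod_def)
  then have row: "steer pos (rho $ Inl k) $ i = u * steer pos (rho $ Inl k) $ j" for k
  proof -
    let ?s = "steer pos (rho $ Inl k)"
    have "?s $ i = (u * cnj u) * ?s $ i * (cnj (?s $ j) * ?s $ j)"
      by (simp add: u_unit mult.commute[of "cnj _"] flip: complex_norm_square)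
    also have "\<dots> = u * w k * ?s $ j"
      by (simp add: w_def mult_ac)
    finally show ?thesis using \<open>w k = 1\<close> by simp
  qed
  have "Rbar pos rho $ i $ l = u * Rbar pos rho $ j $ l" for l
    using sum by (simp add: Rbar_def row sum_distrib_left mult_ac)
  moreover have "\<bar>Re (Rbar pos rho $ j $ l)\<bar> \<le> 1" "\<bar>Im (Rbar pos rho $ j $ l)\<bar> \<le> 1" for l
    using norm_Rbar_le_1[of rho pos j l] pos sum less_imp_le abs_Re_le_cmod abs_Im_le_cmod
    by (meson order_trans)+
  ultimately have Rx_row: "Rx pos rho $ i $ l = u * Rx pos rho $ j $ l" for l
    by (simp add: Rx_def casin_mult_fourth_root_of_unity[OF u])
  obtain B where B: "Rx pos rho ** B = mat 1"
    using inv by (auto simp: invertible_def)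
  \<comment> \<open>Proportionality of rows \<open>i\<close> and \<open>j\<close> survives right
    multiplication by \<open>B\<close>, but fails for the identity.\<close>
  have "(1 :: complex) = (Rx pos rho ** B) $ i $ i"
    by (simp add: B mat_def)
  also have "\<dots> = u * (Rx pos rho ** B) $ j $ i"
    by (simp add: matrix_matrix_mult_def Rx_row sum_distrib_left mult.assoc)
  also have "\<dots> = 0"
    using \<open>i \<noteq> j\<close> by (simp add: B mat_def)
  finally show False by simp
qed

lemma psd_kernel_Re_mult_cnj: "psd_kernel (\<lambda>x y. Re (z x * cnj (z y)))"
  using psd_kernel.add[OF psd_kernel.rank_one[of "\<lambda>x. Re (z x)"] psd_kernel.rank_one[of "\<lambda>x. Im (z x)"]]
  by simp

text \<open>\<open>casin\<close> acts separately on real and imaginary parts. This is entrywise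
  \<open>arcsin\<close> on the real block matrix of \<open>Rbar\<close>, whose block form survives
  because \<open>arcsin\<close> is odd.\<close>

lemma Rx_psd_kernel:
  fixes pos :: "'m::finite \<Rightarrow> int" and rho :: "real^('k::finite + 'k)"
  assumes nonneg: "\<And>k. 0 \<le> rho $ Inr k" and sum: "(\<Sum>k\<in>UNIV. rho $ Inr k) = 1"
  obtains K where "psd_kernel K" "Rx pos rho = complexify K"
proof -
  \<comment> \<open>The weight \<open>-\<i>\<close> gives \<open>Re (-\<i> * z) = Im z\<close>,
    which puts the imaginary part into the mixed blocks with the right signs.\<close>
  define w :: "bool \<Rightarrow> complex" where "w b = (if b then - \<i> else 1)" for b
  define C where "C x y = Re (w (snd x) * cnj (w (snd y)) * Rbar pos rho $ fst x $ fst y)" for x y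
  have bound: "\<bar>C x y\<bar> \<le> 1" for x y
  proof -
    have "\<bar>C x y\<bar> \<le> cmod (w (snd x) * cnj (w (snd y)) * Rbar pos rho $ fst x $ fst y)"
      unfolding C_def by (rule abs_Re_le_cmod)
    also have "\<dots> \<le> 1"
      using norm_Rbar_le_1[of rho pos] assms by (simp add: norm_mult w_def)
    finally show ?thesis .
  qed
  have "C x y = (\<Sum>k\<in>UNIV. rho $ Inr k * Re ((w (snd x) * steer pos (rho $ Inl k) $ fst x) *
      cnj (w (snd y) * steer pos (rho $ Inl k) $ fst y)))" for x y
  proof -
    have "w (snd x) * cnj (w (snd y)) * Rbar pos rho $ fst x $ fst y =
        (\<Sum>k\<in>UNIV. complex_of_real (rho $ Inr k) * ((w (snd x) * steer pos (rho $ Inl k) $ fst x) *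
          cnj (w (snd y) * steer pos (rho $ Inl k) $ fst y)))"
      using sum by (simp add: Rbar_def sum_distrib_left mult_ac)
    then show ?thesis
      unfolding C_def by (simp only: Re_sum Re_complex_of_real Im_complex_of_real times_complex.sel) simp
  qed
  then have "C = (\<lambda>x y. \<Sum>k\<in>UNIV. rho $ Inr k * Re ((w (snd x) * steer pos (rho $ Inl k) $ fst x) *
      cnj (w (snd y) * steer pos (rho $ Inl k) $ fst y)))"
    by blast
  then have "psd_kernel C"
    by (simp only:) (intro psd_kernel_sum psd_kernel_scale nonneg psd_kernel_Re_mult_cnj)
  then have "psd_kernel (\<lambda>x y. 2 / pi * arcsin (C x y))"
    by (intro psd_kernel_scale psd_kernel_arcsin bound) simp
  moreover have "Rx pos rho = complexify (\<lambda>x y. 2 / pi * arcsin (C x y))"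
  proof -
    have "\<bar>Im (Rbar pos rho $ i $ j)\<bar> \<le> 1" for i j
      using norm_Rbar_le_1[of rho pos i j] assms abs_Im_le_cmod order_trans by blast
    then have "arcsin (- Im (Rbar pos rho $ i $ j)) = - arcsin (Im (Rbar pos rho $ i $ j))" for i j
      by (simp add: arcsin_minus abs_le_iff)
    then show ?thesis
      by (simp add: vec_eq_iff complexify_def Rx_def casin_def C_def w_def complex_eq_iff)
  qed
  ultimately show ?thesis by (rule that)
qed

theorem theorem4:
  fixes pos :: "'m::finite \<Rightarrow> int" and \<theta> :: "real^'k::finite"
    and N :: nat and \<sigma>2 :: real
  assumes "inj pos"
    and "inj (\<lambda>k. \<theta> $ k)"
    and "\<forall>k. \<theta> $ k \<in> {-(pi/2)..pi/2}"
    and "N > 0"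
    and "\<sigma>2 > 0"
    and "\<forall>SNR>0. invertible (Rx pos (param \<theta> (npow \<sigma>2 (\<chi> k. SNR * \<sigma>2))))
                 \<and> invertible (FIMw pos N (param \<theta> (npow \<sigma>2 (\<chi> k. SNR * \<sigma>2))))"
    and "invertible (Rx pos (param \<theta> (\<chi> k. 1 / real CARD('k))))
         \<and> invertible (FIMw pos N (param \<theta> (\<chi> k. 1 / real CARD('k))))"
  shows "\<exists>L. ((\<lambda>SNR. CRBw pos N (param \<theta> (npow \<sigma>2 (\<chi> k. SNR * \<sigma>2)))) \<longlongrightarrow> L) at_top
             \<and> posdef L"
proof -
  \<comment> \<open>The parameter at infinite SNR: equal powers and no noise share.\<close>
  define rho where "rho = param \<theta> (\<chi> k. 1 / real CARD('k))"
  define r where "r SNR = param \<theta> (npow \<sigma>2 (\<chi> k. SNR * \<sigma>2))" for SNR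
  have inv: "invertible (Rx pos rho)" "invertible (FIMw pos N rho)"
    using assms(7) by (simp_all add: rho_def)
  have powers: "\<And>k. 0 < rho $ Inr k" "(\<Sum>k\<in>UNIV. rho $ Inr k) = 1"
    by (simp_all add: rho_def param_def)
  have power_limit: "((\<lambda>SNR. SNR * \<sigma>2 / (\<sigma>2 + real CARD('k) * (SNR * \<sigma>2))) \<longlongrightarrow> 1 / real CARD('k)) at_top"
  proof -
    \<comment> \<open>The normalized power after cancelling \<open>SNR * \<sigma>2\<close>.\<close>
    have "((\<lambda>SNR. 1 / (inverse SNR + real CARD('k))) \<longlongrightarrow> 1 / (0 + real CARD('k))) at_top"
      by (intro tendsto_intros tendsto_inverse_0_at_top filterlim_ident) simp
    moreover have "\<forall>\<^sub>F SNR in at_top. 1 / (inverse SNR + real CARD('k)) =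
        SNR * \<sigma>2 / (\<sigma>2 + real CARD('k) * (SNR * \<sigma>2))"
      using eventually_gt_at_top[of 0]
    proof eventually_elim
      case (elim SNR)
      then have "0 < \<sigma>2 + real CARD('k) * (SNR * \<sigma>2)" "0 < inverse SNR + real CARD('k)"
        using assms(5) by (auto intro!: add_pos_nonneg)
      then show ?case
        using elim by (simp add: field_simps)
    qed
    ultimately show ?thesis
      by (simp add: Lim_transform_eventually)
  qed
  have "((\<lambda>SNR. r SNR $ l) \<longlongrightarrow> rho $ l) at_top" for l
    using power_limit by (cases l) (simp_all add: r_def rho_def param_def npow_def)
  then have r: "(r \<longlongrightarrow> rho) at_top"
    by (rule vec_tendstoI)
  have "((\<lambda>SNR. CRBw pos N (r SNR)) \<longlongrightarrow> CRBw pos N rho) at_top"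
    unfolding CRBw_def
    by (intro vec_tendstoI)
      (simp, intro tendsto_matrix_inv tendsto_FIMw r Rbar_offdiag_interior powers inv)
  moreover have "posdef (CRBw pos N rho)"
  proof -
    obtain K where K: "psd_kernel K" and R: "Rx pos rho = complexify K"
      using Rx_psd_kernel[of rho pos] powers less_imp_le by metis
    have "hermitian (Rx pos rho)"
      unfolding hermitian_def R using complexify_hermitian[OF K] by blast
    then show ?thesis
      unfolding CRBw_def
      by (intro posdef_matrix_inv_block hermitian_FIMw inv FIMw_psd[OF R K])
  qed
  ultimately show ?thesis
    by (auto simp: r_def)
qed

end
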